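(* Let $V$ be a Banach space, $\ell=(\ell_1,\dots,\ell_m):V\to\mathbb{R}^m$ a (possibly nonlinear) measurement map, $V_n\subset V$ a (possibly nonlinear) approximation space, and $\|\cdot\|_Z$ a norm on $\mathbb{R}^m$, such that the constants $\alpha_Z$ and $\mu_Z$ defined in the context are finite. Let $1\le p\le\infty$, $u\in V$, $\eta\in\mathbb{R}^m$, and $z=\ell(u)+\eta$. Let $\tilde u$ be the best fit estimator, i.e. $$\tilde u\in\operatorname{argmin}\{\|z-\ell(v)\|_Z\;:\;v\in V_n\}$$ (assumed to exist). Then $$\|u-\tilde u\|_V\le C_1\,e_n(u)+C_2\,\|\eta\|_p,$$ where $C_1:=1+2\alpha_Z\mu_Z$ and $C_2:=2\beta_Z\mu_Z$.
   Context: The approximation space is of the form $V_n=\{\varphi(x):x\in S\}$ for some set $S\subset\mathbb{R}^n$ and some continuous map $\varphi:S\to V$; it need not be linear. Stability of the measurements: $\|\ell(v)-\ell(\tilde v)\|_Z\le\alpha_Z\|v-\tilde v\|_V$ for all $v,\tilde v\in V$, with optimal constant $\alpha_Z=\sup_{v_1\ne v_2\in V}\frac{\|\ell(v_1)-\ell(v_2)\|_Z}{\|v_1-v_2\|_V}<\infty$. Inverse stability over $V_n$: $\|v-\tilde v\|_V\le\mu_Z\|\ell(v)-\ell(\tilde v)\|_Z$ for all $v,\tilde v\in V_n$, with optimal constant $\mu_Z=\sup_{v_1\neq v_2\in V_n}\frac{\|v_1-v_2\|_V}{\|\ell(v_1)-\ell(v_2)\|_Z}<\infty$. $\|\cdot\|_p$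 is the $\ell^p$ norm on $\mathbb{R}^m$, $\beta_Z:=\max_{z\in\mathbb{R}^m\setminus\{0\}}\frac{\|z\|_Z}{\|z\|_p}$, and $e_n(u):=\inf_{v\in V_n}\|u-v\|_V$. *)

theory Defs
  imports "HOL-Analysis.Analysis"
begin

definition is_norm :: "('a::real_vector \<Rightarrow> real) \<Rightarrow> bool" where
  "is_norm N \<longleftrightarrow>
     (\<forall>x. 0 \<le> N x) \<and>
     (\<forall>x. N x = 0 \<longleftrightarrow> x = 0) \<and>
     (\<forall>c x. N (c *\<^sub>R x) = \<bar>c\<bar> * N x) \<and>
     (\<forall>x y. N (x + y) \<le> N x + N y)"

definition lp_norm :: "ennreal \<Rightarrow> real ^ 'm \<Rightarrow> real" where
  "lp_norm p z =
     (if p = \<infinity> then infnorm z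
      else (\<Sum>i\<in>UNIV. \<bar>z $ i\<bar> powr enn2real p) powr (1 / enn2real p))"

text \<open>The two stability constants are suprema in \<open>[0, \<infinity>]\<close>. A supremum over no pairs is
  \<open>0\<close>. In \<open>inv_stability_const\<close>, a pair of distinct points with the same measurements
  contributes \<open>\<infinity>\<close>, because \<open>c / 0 = \<infinity>\<close> for \<open>c > 0\<close> in
  \<^typ>\<open>ennreal\<close>; so finiteness of that constant forces the measurements to be injective
  on the approximation space.\<close>

definition stability_const ::
  "(real ^ 'm \<Rightarrow> real) \<Rightarrow> ('v::real_normed_vector \<Rightarrow> real ^ 'm) \<Rightarrow> ennreal" where
  "stability_const N l =
     (SUP (v1, v2) \<in> {(v1, v2). v1 \<noteq> v2}.
        ennreal (N (l v1 - l v2)) / ennreal (norm (v1 - v2)))"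

definition inv_stability_const ::
  "(real ^ 'm \<Rightarrow> real) \<Rightarrow> ('v::real_normed_vector \<Rightarrow> real ^ 'm) \<Rightarrow> 'v set \<Rightarrow> ennreal" where
  "inv_stability_const N l Vn =
     (SUP (v1, v2) \<in> {(v1, v2). v1 \<in> Vn \<and> v2 \<in> Vn \<and> v1 \<noteq> v2}.
        ennreal (norm (v1 - v2)) / ennreal (N (l v1 - l v2)))"

definition norm_ratio_const :: "(real ^ 'm \<Rightarrow> real) \<Rightarrow> ennreal \<Rightarrow> real" where
  "norm_ratio_const N p = (GREATEST r. \<exists>z. z \<noteq> 0 \<and> r = N z / lp_norm p z)"

definition best_approx_error :: "'v::real_normed_vector set \<Rightarrow> 'v \<Rightarrow> real" where
  "best_approx_error Vn u = (INF v\<in>Vn. norm (u - v))"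

end

theory Submission
  imports Defs
begin

text \<open>The best fit estimator has a residual no larger than that of any competitor
  \<open>v\<close> in the approximation space. By the triangle inequality its measurements are therefore
  within \<open>2 * N (z - l v)\<close> of those of \<open>v\<close>, and inverse stability turns this into a bound on
  the distance from \<open>v\<close> to the estimator. The residual \<open>z - l v\<close> is in turn the
  sum of \<open>l u - l v\<close>, controlled by stability, and the noise \<open>\<eta>\<close>, whose \<open>N\<close>-norm is
  controlled by its \<open>\<ell>\<^sup>p\<close> norm. Taking the infimum over \<open>v\<close> gives the estimate.

  Two points need an argument beyond this chain. The stability constants are suprema in
  \<open>[0, \<infinity>]\<close>, and \<open>ratio_le_imp_le_mult\<close> extracts real inequalities from them. The
  comparison constant of the two norms is a maximum, and \<open>norm_le_norm_ratio_const\<close> shows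
  that it is attained: the quotient is homogeneous of degree zero, hence determined by its
  values on the unit sphere, where it is continuous.\<close>

section \<open>Inequalities from the stability constants\<close>

text \<open>For \<open>b = 0\<close> the quotient is \<open>0\<close> or \<open>\<infinity>\<close> according to whether \<open>a\<close> vanishes, so
  a finite bound on it excludes a positive \<open>a\<close>.\<close>

lemma ratio_le_imp_le_mult:
  fixes a b :: real and c :: ennreal
  assumes "ennreal a / ennreal b \<le> c" "c < \<infinity>" "0 \<le> a" "0 \<le> b"
  shows "a \<le> enn2real c * b"
proof -
  obtain r where r: "c = ennreal r" "0 \<le> r"
    using assms(2) by (cases c) auto
  show ?thesis
  proof (cases "b = 0")
    case True
    have "a = 0"
    proof (rule ccontr)
      assume "a \<noteq> 0"
      then have "ennreal a / ennreal b = \<infinity>"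
        using True assms(3) by (simp add: ennreal_divide_zero)
      then show False using assms(1,2) by (simp add: top_unique)
    qed
    then show ?thesis using True by simp
  next
    case False
    then have "ennreal (a / b) \<le> ennreal r"
      using assms r by (simp add: divide_ennreal)
    then have "a / b \<le> r" using r by simp
    then show ?thesis using False assms(4) r by (simp add: divide_simps)
  qed
qed

lemma is_norm_zero: "is_norm N \<Longrightarrow> N 0 = 0"
  by (auto simp: is_norm_def)

lemma stability_bound:
  assumes N: "is_norm N" and fin: "stability_const N l < \<infinity>"
  shows "N (l v - l w) \<le> enn2real (stability_const N l) * norm (v - w)"
proof (cases "v = w")
  case True
  then show ?thesis using N by (simp add: is_norm_zero)
next
  case False
  then have "ennreal (N (l v - l w)) / ennreal (norm (v - w)) \<le> stability_const N l"
    unfolding stability_const_def by (intro SUP_upper2[of "(v, w)"]) auto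
  then show ?thesis
    using fin N by (intro ratio_le_imp_le_mult) (auto simp: is_norm_def)
qed

lemma inv_stability_bound:
  assumes N: "is_norm N" and fin: "inv_stability_const N l Vn < \<infinity>"
    and "v \<in> Vn" "w \<in> Vn"
  shows "norm (v - w) \<le> enn2real (inv_stability_const N l Vn) * N (l v - l w)"
proof (cases "v = w")
  case True
  then show ?thesis using N by (simp add: is_norm_zero)
next
  case False
  then have "ennreal (norm (v - w)) / ennreal (N (l v - l w)) \<le> inv_stability_const N l Vn"
    unfolding inv_stability_const_def
    using assms(3,4) by (intro SUP_upper2[of "(v, w)"]) auto
  then show ?thesis
    using fin N by (intro ratio_le_imp_le_mult) (auto simp: is_norm_def)
qed

section \<open>Comparison with the p-norm\<close>

text \<open>A norm is convex, and convex functions on a Euclidean space are continuous.\<close>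

lemma continuous_on_is_norm:
  fixes N :: "real ^ 'm \<Rightarrow> real"
  assumes "is_norm N"
  shows "continuous_on A N"
proof -
  have "convex_on UNIV N"
  proof (rule convex_onI)
    fix t :: real and x y :: "real ^ 'm"
    assume "0 < t" "t < 1"
    have "N ((1 - t) *\<^sub>R x + t *\<^sub>R y) \<le> N ((1 - t) *\<^sub>R x) + N (t *\<^sub>R y)"
      using assms unfolding is_norm_def by blast
    also have "\<dots> = \<bar>1 - t\<bar> * N x + \<bar>t\<bar> * N y"
      using assms unfolding is_norm_def by metis
    finally show "N ((1 - t) *\<^sub>R x + t *\<^sub>R y) \<le> (1 - t) * N x + t * N y"
      using \<open>0 < t\<close> \<open>t < 1\<close> by simp
  qed auto
  then have "continuous_on UNIV N" by (intro convex_on_continuous) auto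
  then show ?thesis using continuous_on_subset by blast
qed

lemma enn2real_pos_if_ge_one:
  assumes "1 \<le> (p::ennreal)" "p \<noteq> \<infinity>"
  shows "0 < enn2real p"
  using assms by (cases p) (auto simp: ennreal_le_iff2 simp flip: ennreal_1)

lemma lp_norm_pos:
  fixes z :: "real ^ 'm"
  assumes "z \<noteq> 0"
  shows "0 < lp_norm p z"
proof (cases "p = \<infinity>")
  case True
  then show ?thesis using assms by (simp add: lp_norm_def infnorm_pos_lt)
next
  case False
  obtain i where "z $ i \<noteq> 0" using assms by (auto simp: vec_eq_iff)
  then have "0 < (\<Sum>i\<in>UNIV. \<bar>z $ i\<bar> powr enn2real p)"
    by (intro sum_pos2[of _ i]) auto
  then show ?thesis using False by (simp add: lp_norm_def)
qed

lemma lp_norm_scaleR: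
  fixes z :: "real ^ 'm"
  assumes "1 \<le> p"
  shows "lp_norm p (c *\<^sub>R z) = \<bar>c\<bar> * lp_norm p z"
proof (cases "p = \<infinity>")
  case True
  then show ?thesis by (simp add: lp_norm_def infnorm_mul)
next
  case False
  let ?q = "enn2real p"
  have q: "0 < ?q" using assms False by (rule enn2real_pos_if_ge_one)
  have "(\<Sum>i\<in>UNIV. \<bar>(c *\<^sub>R z) $ i\<bar> powr ?q) = \<bar>c\<bar> powr ?q * (\<Sum>i\<in>UNIV. \<bar>z $ i\<bar> powr ?q)"
    by (simp add: abs_mult powr_mult sum_distrib_left)
  then show ?thesis
    using False q by (simp add: lp_norm_def powr_mult sum_nonneg powr_powr)
qed

lemma continuous_on_lp_norm:
  assumes "1 \<le> p"
  shows "continuous_on A (lp_norm p :: real ^ 'm \<Rightarrow> real)"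
proof (cases "p = \<infinity>")
  case True
  then have "lp_norm p = (infnorm :: real ^ 'm \<Rightarrow> real)" by (simp add: lp_norm_def fun_eq_iff)
  then show ?thesis by (simp add: continuous_on_infnorm continuous_on_id)
next
  case False
  have q: "0 < enn2real p" using assms False by (rule enn2real_pos_if_ge_one)
  have "continuous_on A
    (\<lambda>z :: real ^ 'm. (\<Sum>i\<in>UNIV. \<bar>z $ i\<bar> powr enn2real p) powr (1 / enn2real p))"
    using q by (intro continuous_on_powr' continuous_intros) (auto simp: sum_nonneg)
  then show ?thesis using False by (simp add: lp_norm_def[abs_def])
qed

text \<open>A \<open>GREATEST\<close> term is only meaningful once a maximum is known to exist; it is obtained
  here from compactness of the unit sphere, and homogeneity carries the bound from the sphere
  to every nonzero vector.\<close>

lemma norm_le_norm_ratio_const: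
  fixes N :: "real ^ 'm \<Rightarrow> real"
  assumes N: "is_norm N" and p: "1 \<le> p"
  shows "N z \<le> norm_ratio_const N p * lp_norm p z"
proof -
  let ?f = "\<lambda>z. N z / lp_norm p z"
  let ?S = "sphere (0 :: real ^ 'm) 1"
  have "continuous_on ?S ?f"
  proof (rule continuous_on_divide[OF continuous_on_is_norm[OF N] continuous_on_lp_norm[OF p]],
      rule ballI)
    fix x assume "x \<in> ?S"
    then have "x \<noteq> 0" by auto
    then show "lp_norm p x \<noteq> 0" using lp_norm_pos[of x p] by simp
  qed
  then obtain y where y: "y \<in> ?S" and max: "\<And>x. x \<in> ?S \<Longrightarrow> ?f x \<le> ?f y"
    using continuous_attains_sup[of ?S ?f] by auto
  have bound: "?f x \<le> ?f y" if "x \<noteq> 0" for x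
  proof -
    let ?x = "(1 / norm x) *\<^sub>R x"
    have "N ?x = 1 / norm x * N x"
      using N by (auto simp: is_norm_def)
    moreover have "lp_norm p ?x = 1 / norm x * lp_norm p x"
      using p by (simp add: lp_norm_scaleR)
    ultimately have "?f ?x = ?f x" using that by simp
    moreover have "?f ?x \<le> ?f y" using that by (intro max) simp
    ultimately show ?thesis by simp
  qed
  have ratio: "norm_ratio_const N p = ?f y"
    unfolding norm_ratio_const_def
  proof (rule Greatest_equality)
    have "y \<noteq> 0" using y by auto
    then show "\<exists>z. z \<noteq> 0 \<and> ?f y = ?f z" by blast
  qed (use bound in blast)
  show ?thesis
  proof (cases "z = 0")
    case True
    then have "N z = 0" using N by (simp add: is_norm_zero)
    moreover have "lp_norm p z = 0" using lp_norm_scaleR[OF p, of 0 z] True by simp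
    ultimately show ?thesis by simp
  next
    case False
    then show ?thesis
      using bound[OF False] lp_norm_pos[OF False, of p] ratio by (simp add: pos_divide_le_eq)
  qed
qed

section \<open>The best fit estimator\<close>

theorem theorem2p3:
  fixes l :: "'v::banach \<Rightarrow> real ^ 'm"
    and S :: "(real ^ 'n) set"
    and \<phi> :: "real ^ 'n \<Rightarrow> 'v"
    and Vn :: "'v set"
    and N :: "real ^ 'm \<Rightarrow> real"
    and p :: ennreal
    and u u_est :: 'v
    and \<eta> z :: "real ^ 'm"
  assumes "continuous_on S \<phi>"
    and "Vn = \<phi> ` S"
    and "is_norm N"
    and "stability_const N l < \<infinity>"
    and "inv_stability_const N l Vn < \<infinity>"
    and "1 \<le> p"
    and "z = l u + \<eta>"
    and "is_arg_min (\<lambda>v. N (z - l v)) (\<lambda>v. v \<in> Vn) u_est"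
  shows "norm (u - u_est)
    \<le> (1 + 2 * enn2real (stability_const N l) * enn2real (inv_stability_const N l Vn))
          * best_approx_error Vn u
      + (2 * norm_ratio_const N p * enn2real (inv_stability_const N l Vn)) * lp_norm p \<eta>"
proof -
  define \<alpha> where "\<alpha> = enn2real (stability_const N l)"
  define \<mu> where "\<mu> = enn2real (inv_stability_const N l Vn)"
  define C where "C = 1 + 2 * \<alpha> * \<mu>"
  define D where "D = (2 * norm_ratio_const N p * \<mu>) * lp_norm p \<eta>"
  have nonneg: "0 \<le> \<alpha>" "0 \<le> \<mu>" by (simp_all add: \<alpha>_def \<mu>_def)
  then have C: "0 < C" by (simp add: C_def add_pos_nonneg)
  have est: "u_est \<in> Vn" and best: "\<And>v. v \<in> Vn \<Longrightarrow> N (z - l u_est) \<le> N (z - l v)"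
    using assms(8) by (auto simp: is_arg_min_linorder)
  have tri: "N (x + y) \<le> N x + N y" for x y
    using assms(3) unfolding is_norm_def by blast
  have minus: "N (- x) = N x" for x
  proof -
    have "N ((-1) *\<^sub>R x) = \<bar>-1\<bar> * N x"
      using assms(3) unfolding is_norm_def by blast
    then show ?thesis by simp
  qed
  have pointwise: "norm (u - u_est) \<le> C * norm (u - v) + D" if v: "v \<in> Vn" for v
  proof -
    have "N (l v - l u_est) \<le> N (z - l u_est) + N (z - l v)"
      using tri[of "z - l u_est" "- (z - l v)"] unfolding minus by simp
    also have "\<dots> \<le> 2 * N (z - l v)" using best[OF v] by simp
    also have "\<dots> \<le> 2 * (N (l u - l v) + N \<eta>)"
      using tri[of "l u - l v" \<eta>] by (simp add: assms(7) algebra_simps)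
    also have "\<dots> \<le> 2 * (\<alpha> * norm (u - v) + norm_ratio_const N p * lp_norm p \<eta>)"
      using stability_bound[OF assms(3,4), of u v] norm_le_norm_ratio_const[OF assms(3,6), of \<eta>]
      by (simp add: \<alpha>_def)
    finally have meas:
      "N (l v - l u_est) \<le> 2 * (\<alpha> * norm (u - v) + norm_ratio_const N p * lp_norm p \<eta>)" .
    have "norm (u - u_est) \<le> norm (u - v) + norm (v - u_est)"
      using norm_triangle_ineq[of "u - v" "v - u_est"] by simp
    also have "norm (v - u_est) \<le> \<mu> * N (l v - l u_est)"
      using inv_stability_bound[OF assms(3,5) v est] by (simp add: \<mu>_def)
    also have "\<dots> \<le> \<mu> * (2 * (\<alpha> * norm (u - v) + norm_ratio_const N p * lp_norm p \<eta>))"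
      using meas nonneg by (intro mult_left_mono)
    finally show ?thesis by (simp add: C_def D_def algebra_simps)
  qed
  \<comment> \<open>Since \<open>C\<close> is positive, the bound can be solved for \<open>norm (u - v)\<close> before passing to
      the infimum.\<close>
  have "(norm (u - u_est) - D) / C \<le> best_approx_error Vn u"
    unfolding best_approx_error_def
  proof (rule cINF_greatest)
    show "Vn \<noteq> {}" using est by auto
    show "(norm (u - u_est) - D) / C \<le> norm (u - v)" if "v \<in> Vn" for v
      using pointwise[OF that] C by (simp add: pos_divide_le_eq mult.commute)
  qed
  then have "norm (u - u_est) \<le> C * best_approx_error Vn u + D"
    using C by (simp add: pos_divide_le_eq mult.commute)
  then show ?thesis by (simp add: C_def D_def \<alpha>_def \<mu>_def)
qed

end
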